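(* Let $\varphi:\mathbb{D}\to\mathbb{D}$ be holomorphic and $\alpha\in\mathbb{D}$ such that $\varphi(\alpha)=\alpha$. Assume that $\varphi'(\alpha)=0$. Then the composition operator $C_\varphi f=f\circ\varphi$ on $\mathrm{Hol}(\mathbb{D})$ satisfies $$\sigma(C_\varphi)=\sigma_w(C_\varphi)=\{0,1\}.$$
   Context: $\mathbb{D}$ is the open unit disc and $\mathrm{Hol}(\mathbb{D})$ the Fréchet space of holomorphic functions on $\mathbb{D}$ (uniform convergence on compact sets). For a continuous linear operator $T$ on $\mathrm{Hol}(\mathbb{D})$, $\sigma(T)=\{\lambda\in\mathbb{C}:\lambda\,\mathrm{Id}-T\text{ is not bijective}\}$. The Waelbroeck spectrum $\sigma_w(T)\subset\mathbb{C}$ is defined by: $\lambda\in\mathbb{C}\setminus\sigma_w(T)$ if and only if $\lambda\in\mathbb{C}\setminus\sigma(T)$ and there is a neighborhood $\mathcal{V}$ of $\lambda$ in $\mathbb{C}$, $\mathcal V\subset\mathbb{C}\setminus\sigma(T)$, such that the family of operators $((\mu\,\mathrm{Id}-T)^{-1})_{\mu\in\mathcal{V}}$ is bounded, meaning that for each $f\in\mathrm{Hol}(\mathbb{D})$ the set $\{(\mu\,\mathrm{Id}-T)^{-1}f:\mu\in\mathcal{V}\}$ is bounded in $\mathrm{Hol}(\mathbb{D})$. A subset $A\subset\mathrm{Hol}(\mathbb{D})$ is bounded if $\sup_{f\in A}\sup_{z\in K}|f(z)|<\infty$ for every compact $K\subset\mathbb{D}$. *)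

theory Defs
  imports "HOL-Complex_Analysis.Complex_Analysis"
begin

text \<open>
  A holomorphic function on the open unit disc is represented by the unique total function that
  agrees with it on the disc and is \<open>0\<close> elsewhere. Equality in \<open>Hol_disc\<close> is then
  equality on the disc, and the vector space operations are pointwise.
\<close>

abbreviation unit_disc :: "complex set" where
  "unit_disc \<equiv> ball 0 1"

definition Hol_disc :: "(complex \<Rightarrow> complex) set" where
  "Hol_disc = {f. f holomorphic_on unit_disc \<and> (\<forall>z. z \<notin> unit_disc \<longrightarrow> f z = 0)}"

definition bounded_Hol :: "(complex \<Rightarrow> complex) set \<Rightarrow> bool" where
  "bounded_Hol A \<longleftrightarrow> A \<subseteq> Hol_disc \<and>
     (\<forall>K. compact K \<and> K \<subseteq> unit_disc \<longrightarrow> (\<exists>M. \<forall>f\<in>A. \<forall>z\<in>K. norm (f z) \<le> M))"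

text \<open>
  An operator on \<open>Hol_disc\<close> is a total map on functions of which only the restriction to
  \<open>Hol_disc\<close> matters. The definitions below make sense for any such map and are intended for
  continuous linear ones.
\<close>

definition shifted_op ::
  "((complex \<Rightarrow> complex) \<Rightarrow> (complex \<Rightarrow> complex)) \<Rightarrow> complex \<Rightarrow>
   (complex \<Rightarrow> complex) \<Rightarrow> (complex \<Rightarrow> complex)" where
  "shifted_op T c f = (\<lambda>z. c * f z - T f z)"

definition Hol_spectrum ::
  "((complex \<Rightarrow> complex) \<Rightarrow> (complex \<Rightarrow> complex)) \<Rightarrow> complex set" where
  "Hol_spectrum T = {c. \<not> bij_betw (shifted_op T c) Hol_disc Hol_disc}"

definition Hol_resolvent ::
  "((complex \<Rightarrow> complex) \<Rightarrow> (complex \<Rightarrow> complex)) \<Rightarrow> complex \<Rightarrow>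
   (complex \<Rightarrow> complex) \<Rightarrow> (complex \<Rightarrow> complex)" where
  "Hol_resolvent T \<mu> = inv_into Hol_disc (shifted_op T \<mu>)"

definition waelbroeck_spectrum ::
  "((complex \<Rightarrow> complex) \<Rightarrow> (complex \<Rightarrow> complex)) \<Rightarrow> complex set" where
  "waelbroeck_spectrum T = - {c. c \<notin> Hol_spectrum T \<and>
     (\<exists>V. c \<in> interior V \<and> V \<subseteq> - Hol_spectrum T \<and>
        (\<forall>f\<in>Hol_disc. bounded_Hol ((\<lambda>\<mu>. Hol_resolvent T \<mu> f) ` V)))}"

definition composition_op ::
  "(complex \<Rightarrow> complex) \<Rightarrow> (complex \<Rightarrow> complex) \<Rightarrow> (complex \<Rightarrow> complex)" where
  "composition_op \<phi> f = (\<lambda>z. if z \<in> unit_disc then f (\<phi> z) else 0)"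

lemma composition_op_in_Hol_disc:
  assumes "\<phi> holomorphic_on unit_disc" "\<phi> ` unit_disc \<subseteq> unit_disc" "f \<in> Hol_disc"
  shows "composition_op \<phi> f \<in> Hol_disc"
proof -
  have "(f \<circ> \<phi>) holomorphic_on unit_disc"
    using assms by (intro holomorphic_on_compose_gen) (auto simp: Hol_disc_def)
  then have "composition_op \<phi> f holomorphic_on unit_disc"
    by (rule holomorphic_transform) (simp add: composition_op_def)
  then show ?thesis
    by (simp add: Hol_disc_def composition_op_def)
qed

end

theory Submission
  imports Defs
begin

text \<open>
  By the Schwarz lemma of order two, in a disc coordinate centred at \<open>\<alpha>\<close> the iterates satisfy
  \<open>\<bar>\<phi>\<^sup>n z\<bar> \<le> \<bar>z\<bar>\<^bsup>2^n\<^esup>\<close>. Hence for every \<open>c \<notin> {0, 1}\<close> the Neumann-type series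
  \<open>g \<alpha> / (c - 1) + (\<Sum>n. (g (\<phi>\<^sup>n z) - g \<alpha>) / c\<^bsup>n+1\<^esup>)\<close>
  converges locally uniformly, however small \<open>c\<close> is, and represents the resolvent; its bounds are
  locally uniform in \<open>c\<close>. The value \<open>1\<close> lies in the spectrum because of the constants, and \<open>0\<close>
  because every function in the range has vanishing derivative at \<open>\<alpha>\<close>.
\<close>

section \<open>Two estimates: Schwarz at a double zero, and doubly exponential decay against
  geometric growth\<close>

text \<open>Dividing by the variable gives \<open>f w = w * h w\<close> with
  \<open>h 0 = deriv f 0 = 0\<close>. The classical Schwarz lemma for \<open>f\<close>, with its
  equality case excluded, makes \<open>h\<close> a self-map of the disc, and the same lemma applied
  to \<open>h\<close> supplies the second factor.\<close>

lemma Schwarz_Lemma_order_2: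
  assumes holf: "f holomorphic_on ball 0 1" and f0: "f 0 = 0" and df0: "deriv f 0 = 0"
    and lt1: "\<And>z. norm z < 1 \<Longrightarrow> norm (f z) < 1" and z: "norm z < 1"
  shows "norm (f z) \<le> norm z ^ 2"
proof -
  obtain h where holh: "h holomorphic_on ball 0 1"
    and fh: "\<And>w. norm w < 1 \<Longrightarrow> f w = w * h w" and h0: "h 0 = 0"
    using Schwarz3[OF holf f0] df0 by metis
  have "norm (h w) < 1" if w: "norm w < 1" for w
  proof (cases "w = 0")
    case False
    \<comment> \<open>Equality at one nonzero point would make \<open>f\<close> a rotation, whose
      derivative at 0 has modulus 1.\<close>
    have "norm (f w) \<noteq> norm w"
    proof
      assume "norm (f w) = norm w"
      then obtain \<beta> where \<beta>: "\<And>u. norm u < 1 \<Longrightarrow> f u = \<beta> * u" "norm \<beta> = 1"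
        using Schwarz_Lemma(3)[OF holf f0 lt1, of 0] w False by (metis norm_zero zero_less_one)
      have "eventually (\<lambda>u. f u = \<beta> * u) (nhds 0)"
        using eventually_nhds_in_open[of "ball 0 1" "0::complex"] \<beta>(1)
        by (auto elim!: eventually_mono)
      then have "deriv f 0 = deriv (\<lambda>u. \<beta> * u) 0"
        by (rule deriv_cong_ev) simp
      then show False
        using df0 \<beta>(2) by auto
    qed
    moreover have "norm (f w) \<le> norm w"
      using Schwarz_Lemma(1)[OF holf f0 lt1 w] .
    ultimately show ?thesis
      using fh[OF w] False by (simp add: norm_mult)
  qed (simp add: h0)
  then have "norm (h z) \<le> norm z"
    using Schwarz_Lemma(1)[OF holh h0 _ z] by blast
  then show ?thesis
    using fh[OF z] by (simp add: norm_mult power2_eq_square mult_left_mono)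
qed

text \<open>Squaring \<open>r ^ (2 ^ n)\<close> gives the next such power, so the ratio of
  consecutive terms has modulus \<open>\<bar>q\<bar> * r ^ (2 ^ n)\<close>, which tends to 0 for
  every \<open>q\<close>. The intended \<open>q\<close> is the inverse of a lower bound for the
  modulus of the spectral parameter, which may be arbitrarily small.\<close>

lemma summable_power_times_double_power:
  fixes q r :: real
  assumes "0 \<le> r" "r < 1"
  shows "summable (\<lambda>n. q ^ n * r ^ (2 ^ n))"
proof -
  have "filterlim (\<lambda>n::nat. (2::nat) ^ n) at_top sequentially"
    by (rule filterlim_subseq) (simp add: strict_mono_def)
  then have "(\<lambda>n. r ^ (2 ^ n)) \<longlonglongrightarrow> 0"
    using LIMSEQ_power_zero[of r] assms by (auto intro: filterlim_compose)
  then have "(\<lambda>n. \<bar>q\<bar> * r ^ (2 ^ n)) \<longlonglongrightarrow> 0"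
    by (rule tendsto_mult_right_zero)
  then have "eventually (\<lambda>n. \<bar>q\<bar> * r ^ (2 ^ n) < 1 / 2) sequentially"
    by (rule order_tendstoD) simp
  then obtain N where N: "\<And>n. n \<ge> N \<Longrightarrow> \<bar>q\<bar> * r ^ (2 ^ n) < 1 / 2"
    by (auto simp: eventually_sequentially)
  show ?thesis
  proof (rule summable_ratio_test[where N = N and c = "1 / 2"])
    fix n assume n: "n \<ge> N"
    have "norm (q ^ Suc n * r ^ 2 ^ Suc n)
        = (\<bar>q\<bar> * r ^ (2 ^ n)) * norm (q ^ n * r ^ (2 ^ n))"
      using assms by (simp add: abs_mult power_abs mult_2 power_add)
    also have "\<dots> \<le> 1 / 2 * norm (q ^ n * r ^ (2 ^ n))"
      using N[OF n] by (intro mult_right_mono) auto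
    finally show "norm (q ^ Suc n * r ^ 2 ^ Suc n) \<le> 1 / 2 * norm (q ^ n * r ^ (2 ^ n))" .
  qed simp
qed

section \<open>Orbits of a disc self-map with a superattracting fixed point\<close>

locale superattracting_self_map =
  fixes \<phi> :: "complex \<Rightarrow> complex" and \<alpha> :: complex
  assumes hol: "\<phi> holomorphic_on unit_disc"
    and maps: "\<phi> ` unit_disc \<subseteq> unit_disc"
    and \<alpha>_in: "\<alpha> \<in> unit_disc"
    and fixed: "\<phi> \<alpha> = \<alpha>"
    and deriv_0: "deriv \<phi> \<alpha> = 0"
begin

lemma funpow_in: "z \<in> unit_disc \<Longrightarrow> (\<phi> ^^ n) z \<in> unit_disc"
  using maps by (induction n) (auto simp: image_subset_iff simp del: mem_ball mem_ball_0)

lemma holomorphic_funpow: "(\<phi> ^^ n) holomorphic_on unit_disc"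
proof (induction n)
  case (Suc n)
  have "(\<phi> \<circ> (\<phi> ^^ n)) holomorphic_on unit_disc"
    using Suc funpow_in by (intro holomorphic_on_compose_gen[OF _ hol]) (auto simp del: mem_ball mem_ball_0)
  then show ?case by (simp add: o_def)
qed simp

lemma holomorphic_compose_funpow:
  "g holomorphic_on unit_disc \<Longrightarrow> (\<lambda>z. g ((\<phi> ^^ n) z)) holomorphic_on unit_disc"
  using holomorphic_on_compose_gen[OF holomorphic_funpow, of g unit_disc] funpow_in
  by (simp add: o_def image_subset_iff del: mem_ball mem_ball_0)

text \<open>A disc automorphism \<open>M\<close> with inverse \<open>N\<close> moves \<alpha> to 0.
  The conjugate \<open>M \<circ> \<phi> \<circ> N\<close> has a double zero there, so each iteration
  at least squares the modulus of the coordinate. Since \<open>g\<close> vanishes at \<alpha>, its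
  values along an orbit are at most a constant times that modulus. The constants depend on
  \<open>g\<close> and \<open>K\<close> only.\<close>

lemma orbit_decay:
  assumes holg: "g holomorphic_on unit_disc" and g\<alpha>: "g \<alpha> = 0"
    and K: "compact K" "K \<subseteq> unit_disc"
  obtains C r where "0 \<le> C" "0 \<le> r" "r < 1"
    "\<And>n z. z \<in> K \<Longrightarrow> norm (g ((\<phi> ^^ n) z)) \<le> C * r ^ (2 ^ n)"
proof -
  obtain M N where M: "M \<alpha> = 0" "M holomorphic_on unit_disc" "M ` unit_disc \<subseteq> unit_disc"
    and N: "N holomorphic_on unit_disc" "N ` unit_disc \<subseteq> unit_disc"
    and MN: "\<And>z. z \<in> unit_disc \<Longrightarrow> M (N z) = z" and NM: "\<And>z. z \<in> unit_disc \<Longrightarrow> N (M z) = z"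
    using ball_biholomorphism_exists[OF \<alpha>_in] by metis
  have M_in: "M z \<in> unit_disc" if "z \<in> unit_disc" for z using M(3) that by blast
  have N_in: "N z \<in> unit_disc" if "z \<in> unit_disc" for z using N(2) that by blast
  have N0: "N 0 = \<alpha>" using NM[OF \<alpha>_in] M(1) by simp
  define \<psi> where "\<psi> = M \<circ> (\<phi> \<circ> N)"
  have hol\<phi>N: "(\<phi> \<circ> N) holomorphic_on unit_disc"
    using N by (intro holomorphic_on_compose_gen[OF _ hol])
  have hol\<psi>: "\<psi> holomorphic_on unit_disc"
    unfolding \<psi>_def using N(2) maps
    by (intro holomorphic_on_compose_gen[OF hol\<phi>N M(2)]) (auto simp: image_subset_iff simp del: mem_ball mem_ball_0)
  have "deriv \<psi> 0 = 0"
  proof -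
    have dN: "(N has_field_derivative deriv N 0) (at 0)"
      using N(1) by (intro holomorphic_derivI[of _ unit_disc]) auto
    have d\<phi>: "(\<phi> has_field_derivative 0) (at (N 0))"
      using holomorphic_derivI[OF hol _ \<alpha>_in] deriv_0 N0 by simp
    have dM: "(M has_field_derivative deriv M \<alpha>) (at ((\<phi> \<circ> N) 0))"
      using holomorphic_derivI[OF M(2) _ \<alpha>_in] N0 fixed by simp
    have "(\<psi> has_field_derivative deriv M \<alpha> * (0 * deriv N 0)) (at 0)"
      unfolding \<psi>_def by (intro DERIV_chain dM d\<phi> dN)
    then show ?thesis by (simp add: DERIV_imp_deriv)
  qed
  moreover have "\<psi> 0 = 0" by (simp add: \<psi>_def N0 fixed M(1))
  moreover have "norm (\<psi> w) < 1" if "norm w < 1" for w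
  proof -
    have "w \<in> unit_disc" using that by simp
    then have "M (\<phi> (N w)) \<in> unit_disc"
      using M_in N_in maps by blast
    then show ?thesis by (simp add: \<psi>_def)
  qed
  ultimately have \<psi>_le: "norm (\<psi> w) \<le> norm w ^ 2" if "norm w < 1" for w
    using Schwarz_Lemma_order_2[OF hol\<psi>] that by blast
  \<comment> \<open>In the coordinate \<open>M\<close>, one application of \<phi> is one application
    of \<psi>, so the exponent doubles at each step.\<close>
  have M_le: "norm (M ((\<phi> ^^ n) z)) \<le> norm (M z) ^ (2 ^ n)" if z: "z \<in> unit_disc" for n z
  proof (induction n)
    case (Suc n)
    let ?w = "(\<phi> ^^ n) z"
    have w: "?w \<in> unit_disc" by (rule funpow_in[OF z])
    have "norm (M ((\<phi> ^^ Suc n) z)) = norm (\<psi> (M ?w))"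
      using NM[OF w] by (simp add: \<psi>_def)
    also have "\<dots> \<le> norm (M ?w) ^ 2"
      using M_in[OF w] by (intro \<psi>_le) simp
    also have "\<dots> \<le> (norm (M z) ^ (2 ^ n)) ^ 2"
      using Suc by (intro power_mono) auto
    finally show ?case by (simp add: power_mult[symmetric] mult.commute)
  qed simp
  have "continuous_on K M"
    using M(2) K(2) holomorphic_on_imp_continuous_on continuous_on_subset by blast
  then have "compact (M ` K)" using K(1) by (rule compact_continuous_image)
  moreover have "M ` K \<subseteq> unit_disc" using M_in K(2) by blast
  ultimately obtain r where r: "0 < r" "r < 1" "\<And>z. z \<in> K \<Longrightarrow> norm (M z) \<le> r"
  proof -
    have "\<exists>s<1. \<forall>w\<in>M ` K. norm w \<le> s"
    proof (cases "M ` K = {}")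
      case False
      then obtain u where "u \<in> M ` K" "\<And>w. w \<in> M ` K \<Longrightarrow> norm w \<le> norm u"
        using continuous_attains_sup[OF \<open>compact (M ` K)\<close>, of norm] by (auto intro: continuous_intros)
      then show ?thesis using \<open>M ` K \<subseteq> unit_disc\<close> by (intro exI[of _ "norm u"]) auto
    qed (auto intro: exI[of _ 0])
    then obtain s where "s < 1" "\<And>z. z \<in> K \<Longrightarrow> norm (M z) \<le> s" by blast
    \<comment> \<open>The maximum with 1/2 keeps the radius positive even if \<open>K\<close> is
      empty or contains only \<alpha>.\<close>
    then show ?thesis by (intro that[of "max s (1/2)"]) (auto intro: le_max_iff_disj[THEN iffD2])
  qed
  \<comment> \<open>Splitting off the zero of \<open>g \<circ> N\<close> at 0 leaves a holomorphic
    factor \<open>H\<close>, bounded on the closed disc of radius \<open>r\<close>.\<close>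
  have "(g \<circ> N) holomorphic_on unit_disc"
    using N by (intro holomorphic_on_compose_gen[OF _ holg])
  then obtain H where H: "H holomorphic_on unit_disc" "\<And>w. norm w < 1 \<Longrightarrow> (g \<circ> N) w = w * H w"
    using Schwarz3[of "g \<circ> N" 1] N0 g\<alpha> by (metis comp_apply)
  have "cball 0 r \<subseteq> unit_disc" using r by auto
  then have "compact (H ` cball 0 r)"
    using H(1) holomorphic_on_imp_continuous_on continuous_on_subset compact_continuous_image
      compact_cball by metis
  then obtain B where B: "B > 0" "\<And>w. w \<in> cball 0 r \<Longrightarrow> norm (H w) \<le> B"
    using compact_imp_bounded[THEN bounded_pos[THEN iffD1]] by (metis imageI)
  show ?thesis
  proof (rule that[of B r])
    fix n z assume z: "z \<in> K"
    let ?w = "M ((\<phi> ^^ n) z)"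
    have z': "z \<in> unit_disc" using z K(2) by blast
    have w: "norm ?w \<le> r ^ (2 ^ n)"
      using M_le[OF z', of n] power_mono[OF r(3)[OF z], of "2 ^ n"] by simp
    \<comment> \<open>As \<open>2 ^ n\<close> is at least 1, the whole orbit stays in the closed
      disc where \<open>B\<close> bounds \<open>H\<close>.\<close>
    also have "\<dots> \<le> r"
      using power_decreasing[of 1 "2 ^ n" r] r by simp
    finally have wr: "norm ?w \<le> r" .
    have "g ((\<phi> ^^ n) z) = ?w * H ?w"
      using H(2)[of ?w] NM[OF funpow_in[OF z']] wr r by simp
    also have "norm \<dots> \<le> r ^ (2 ^ n) * B"
      using w B(2)[of ?w] wr r(1) by (auto simp: norm_mult intro!: mult_mono)
    finally show "norm (g ((\<phi> ^^ n) z)) \<le> B * r ^ (2 ^ n)" by (simp add: mult.commute)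
  qed (use B r in auto)
qed

section \<open>The resolvent as a modified Neumann series\<close>

text \<open>Subtracting \<open>g \<alpha>\<close> is what brings in \<open>orbit_decay\<close>.
  Without it the terms would behave like \<open>g \<alpha> / c ^ Suc n\<close>, and the series would
  diverge for \<open>norm c \<le> 1\<close> whenever \<open>g \<alpha>\<close> is nonzero.\<close>

definition resolvent_term :: "complex \<Rightarrow> (complex \<Rightarrow> complex) \<Rightarrow> nat \<Rightarrow> complex \<Rightarrow> complex" where
  "resolvent_term c g n z = (g ((\<phi> ^^ n) z) - g \<alpha>) / c ^ Suc n"

text \<open>The separate summand restores the subtracted constant: composition fixes constants, so
  the resolvent multiplies them by \<open>1 / (c - 1)\<close>. The value 0 off the disc is the
  normalisation of \<open>Hol_disc\<close>.\<close>

definition resolvent_series :: "complex \<Rightarrow> (complex \<Rightarrow> complex) \<Rightarrow> complex \<Rightarrow> complex" where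
  "resolvent_series c g z =
     (if z \<in> unit_disc then g \<alpha> / (c - 1) + (\<Sum>n. resolvent_term c g n z) else 0)"

text \<open>One majorant serves two purposes: uniformity in \<open>z\<close> gives holomorphy of the
  series by the Weierstrass M-test, and uniformity in \<open>c\<close> gives boundedness of the
  family of resolvents.\<close>

lemma resolvent_term_bound:
  assumes "g \<in> Hol_disc" "compact K" "K \<subseteq> unit_disc" "\<delta> > 0"
  obtains B where "summable B"
    "\<And>c n z. norm c \<ge> \<delta> \<Longrightarrow> z \<in> K \<Longrightarrow> norm (resolvent_term c g n z) \<le> B n"
proof -
  have "(\<lambda>z. g z - g \<alpha>) holomorphic_on unit_disc"
    using assms(1) by (auto simp: Hol_disc_def intro!: holomorphic_intros)
  then obtain C r where Cr: "0 \<le> C" "0 \<le> r" "r < 1"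
    "\<And>n z. z \<in> K \<Longrightarrow> norm (g ((\<phi> ^^ n) z) - g \<alpha>) \<le> C * r ^ (2 ^ n)"
    using orbit_decay[of "\<lambda>z. g z - g \<alpha>" K] assms(2,3) by auto
  show ?thesis
  proof (rule that[of "\<lambda>n. (C / \<delta>) * ((1 / \<delta>) ^ n * r ^ (2 ^ n))"])
    show "summable (\<lambda>n. (C / \<delta>) * ((1 / \<delta>) ^ n * r ^ (2 ^ n)))"
      by (intro summable_mult summable_power_times_double_power Cr)
  next
    fix c :: complex and n z assume c: "norm c \<ge> \<delta>" and z: "z \<in> K"
    have "norm (resolvent_term c g n z) = norm (g ((\<phi> ^^ n) z) - g \<alpha>) / norm c ^ Suc n"
      by (simp add: resolvent_term_def norm_divide norm_mult norm_power)
    also have "\<dots> \<le> (C * r ^ (2 ^ n)) / \<delta> ^ Suc n"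
      using Cr z c \<open>\<delta> > 0\<close> by (intro frac_le power_mono zero_less_power) auto
    finally show "norm (resolvent_term c g n z) \<le> (C / \<delta>) * ((1 / \<delta>) ^ n * r ^ (2 ^ n))"
      by (simp add: power_divide mult_ac)
  qed
qed

lemma summable_resolvent_term:
  assumes "g \<in> Hol_disc" "z \<in> unit_disc" "c \<noteq> 0"
  shows "summable (\<lambda>n. resolvent_term c g n z)"
proof -
  have "compact {z}" "{z} \<subseteq> unit_disc" "norm c > 0" using assms by auto
  then obtain B where B: "summable B"
    "\<And>c' n w. norm c' \<ge> norm c \<Longrightarrow> w \<in> {z} \<Longrightarrow> norm (resolvent_term c' g n w) \<le> B n"
    using resolvent_term_bound[OF assms(1)] by blast
  show ?thesis by (rule summable_comparison_test'[OF B(1)]) (rule B(2); simp)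
qed

text \<open>The partial sums are holomorphic and converge uniformly on closed discs, with
  \<open>norm c\<close> as the lower bound \<delta> of the majorant. At \<open>c = 1\<close> the
  separate summand is the constant 0, by the convention for division by zero.\<close>

lemma resolvent_series_in_Hol_disc:
  assumes g: "g \<in> Hol_disc" and c: "c \<noteq> 0"
  shows "resolvent_series c g \<in> Hol_disc"
proof -
  have "(\<lambda>z. \<Sum>n. resolvent_term c g n z) holomorphic_on unit_disc"
  proof (rule holomorphic_uniform_sequence[OF open_ball])
    fix n
    have "(\<lambda>z. g ((\<phi> ^^ k) z)) holomorphic_on unit_disc" for k
      using g by (intro holomorphic_compose_funpow) (simp add: Hol_disc_def)
    then show "(\<lambda>z. \<Sum>k<n. resolvent_term c g k z) holomorphic_on unit_disc"
      unfolding resolvent_term_def using c by (intro holomorphic_intros) auto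
  next
    fix x :: complex assume "x \<in> unit_disc"
    then obtain d where d: "d > 0" "cball x d \<subseteq> unit_disc"
      using open_contains_cball open_ball by metis
    have "norm c > 0" using c by simp
    then obtain B where B: "summable B"
      "\<And>c' n z. norm c' \<ge> norm c \<Longrightarrow> z \<in> cball x d \<Longrightarrow> norm (resolvent_term c' g n z) \<le> B n"
      using resolvent_term_bound[OF g compact_cball d(2)] by blast
    have "uniform_limit (cball x d) (\<lambda>n z. \<Sum>k<n. resolvent_term c g k z)
        (\<lambda>z. \<Sum>n. resolvent_term c g n z) sequentially"
      by (intro Weierstrass_m_test[OF _ B(1)] B(2)) auto
    then show "\<exists>d>0. cball x d \<subseteq> unit_disc \<and>
        uniform_limit (cball x d) (\<lambda>n z. \<Sum>k<n. resolvent_term c g k z)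
          (\<lambda>z. \<Sum>n. resolvent_term c g n z) sequentially"
      using d by blast
  qed
  then have "(\<lambda>z. g \<alpha> / (c - 1) + (\<Sum>n. resolvent_term c g n z)) holomorphic_on unit_disc"
    by (intro holomorphic_on_add holomorphic_on_const)
  then have "resolvent_series c g holomorphic_on unit_disc"
    by (rule holomorphic_transform) (simp add: resolvent_series_def)
  then show ?thesis
    by (simp add: Hol_disc_def resolvent_series_def)
qed

text \<open>Composition with \<phi> shifts the series by one index and multiplies it by
  \<open>c\<close>. Hence \<open>c\<close> times the sum minus the composed sum telescopes to
  \<open>c\<close> times the term of index 0, which is \<open>g z - g \<alpha>\<close>; the separate
  summand contributes the missing \<open>g \<alpha>\<close>.\<close>

lemma shifted_op_resolvent_series:
  assumes g: "g \<in> Hol_disc" and c: "c \<noteq> 0" "c \<noteq> 1"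
  shows "shifted_op (composition_op \<phi>) c (resolvent_series c g) = g"
proof
  fix z
  show "shifted_op (composition_op \<phi>) c (resolvent_series c g) z = g z"
  proof (cases "z \<in> unit_disc")
    case True
    have \<phi>z: "\<phi> z \<in> unit_disc" using True maps by blast
    have shift: "resolvent_term c g n (\<phi> z) = c * resolvent_term c g (Suc n) z" for n
      using c by (simp add: resolvent_term_def funpow_swap1)
    have "(\<Sum>n. resolvent_term c g n (\<phi> z)) = c * (\<Sum>n. resolvent_term c g (Suc n) z)"
      unfolding shift using summable_resolvent_term[OF g True c(1)]
      by (intro suminf_mult) (subst summable_Suc_iff)
    also have "\<dots> = c * ((\<Sum>n. resolvent_term c g n z) - resolvent_term c g 0 z)"
      using suminf_split_head[OF summable_resolvent_term[OF g True c(1)]] by simp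
    also have "\<dots> = c * (\<Sum>n. resolvent_term c g n z) - (g z - g \<alpha>)"
      using c by (simp add: resolvent_term_def field_simps)
    finally have "shifted_op (composition_op \<phi>) c (resolvent_series c g) z
        = (c - 1) * (g \<alpha> / (c - 1)) + (g z - g \<alpha>)"
      using True \<phi>z unfolding shifted_op_def composition_op_def resolvent_series_def
      by (simp add: algebra_simps del: mem_ball mem_ball_0 times_divide_eq_right times_divide_eq_left)
    then show ?thesis using c by simp
  next
    case False
    then show ?thesis
      using g by (simp add: shifted_op_def composition_op_def resolvent_series_def Hol_disc_def)
  qed
qed

section \<open>Injectivity and bijectivity away from 0 and 1\<close>

text \<open>The difference of two functions with the same image solves Schroeder's equation
  \<open>f (\<phi> z) = c * f z\<close>. At \<alpha> this forces \<open>f \<alpha> = 0\<close>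
  because \<open>c\<close> is not 1, so \<open>f\<close> decays doubly exponentially along orbits,
  whereas iterating the equation allows only the geometric rate \<open>c ^ n\<close> unless
  \<open>f\<close> is zero.\<close>

lemma inj_on_shifted_op:
  assumes c: "c \<noteq> 0" "c \<noteq> 1"
  shows "inj_on (shifted_op (composition_op \<phi>) c) Hol_disc"
proof (rule inj_onI)
  fix f1 f2 assume f: "f1 \<in> Hol_disc" "f2 \<in> Hol_disc"
    and eq: "shifted_op (composition_op \<phi>) c f1 = shifted_op (composition_op \<phi>) c f2"
  define f where "f z = f1 z - f2 z" for z
  have holf: "f holomorphic_on unit_disc"
    using f unfolding f_def Hol_disc_def by (auto intro!: holomorphic_intros)
  have step: "f (\<phi> z) = c * f z" if "z \<in> unit_disc" for z
    using fun_cong[OF eq, of z] that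
    by (simp add: f_def shifted_op_def composition_op_def algebra_simps del: mem_ball mem_ball_0)
  have f\<alpha>: "f \<alpha> = 0"
    using step[OF \<alpha>_in] c fixed by simp
  have iter: "f ((\<phi> ^^ n) z) = c ^ n * f z" if "z \<in> unit_disc" for n z
    by (induction n) (simp_all add: step[OF funpow_in[OF that]] del: mem_ball mem_ball_0)
  have "f z = 0" if z: "z \<in> unit_disc" for z
  proof -
    have "compact {z}" "{z} \<subseteq> unit_disc" using z by auto
    then obtain C r where Cr: "0 \<le> r" "r < 1" "\<And>n. norm (f ((\<phi> ^^ n) z)) \<le> C * r ^ (2 ^ n)"
      using orbit_decay[OF holf f\<alpha>] by (metis singletonI)
    have "(\<lambda>n. (1 / norm c) ^ n * r ^ (2 ^ n)) \<longlonglongrightarrow> 0"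
      by (intro summable_LIMSEQ_zero summable_power_times_double_power Cr)
    then have "(\<lambda>n. C * ((1 / norm c) ^ n * r ^ (2 ^ n))) \<longlonglongrightarrow> 0"
      by (rule tendsto_mult_right_zero)
    moreover have "norm (f z) \<le> C * ((1 / norm c) ^ n * r ^ (2 ^ n))" for n
      using Cr(3)[of n] c(1) iter[OF z, of n]
      by (simp add: norm_mult norm_power field_simps)
    ultimately have "norm (f z) \<le> 0"
      by (intro LIMSEQ_le_const) auto
    then show ?thesis by simp
  qed
  \<comment> \<open>Off the disc both functions are 0 by the normalisation of
    \<open>Hol_disc\<close>.\<close>
  then show "f1 = f2"
    using f by (fastforce simp: f_def Hol_disc_def fun_eq_iff simp del: mem_ball mem_ball_0)
qed

lemma bij_betw_shifted_op:
  assumes c: "c \<noteq> 0" "c \<noteq> 1"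
  shows "bij_betw (shifted_op (composition_op \<phi>) c) Hol_disc Hol_disc"
proof (rule bij_betw_imageI[OF inj_on_shifted_op[OF c]])
  have "shifted_op (composition_op \<phi>) c f \<in> Hol_disc" if f: "f \<in> Hol_disc" for f
    using f composition_op_in_Hol_disc[OF hol maps f]
    by (auto simp: Hol_disc_def shifted_op_def intro!: holomorphic_intros)
  moreover have "g \<in> shifted_op (composition_op \<phi>) c ` Hol_disc" if "g \<in> Hol_disc" for g
    using shifted_op_resolvent_series[OF that c] resolvent_series_in_Hol_disc[OF that c(1)]
    by (metis imageI)
  ultimately show "shifted_op (composition_op \<phi>) c ` Hol_disc = Hol_disc" by blast
qed

lemma Hol_resolvent_eq:
  assumes "c \<noteq> 0" "c \<noteq> 1" "g \<in> Hol_disc"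
  shows "Hol_resolvent (composition_op \<phi>) c g = resolvent_series c g"
  unfolding Hol_resolvent_def
  using inj_on_shifted_op[of c] resolvent_series_in_Hol_disc shifted_op_resolvent_series assms
  by (intro inv_into_f_eq) auto

section \<open>The spectrum\<close>

lemma Hol_spectrum_composition_op: "Hol_spectrum (composition_op \<phi>) = {0, 1}"
proof -
  have "0 \<in> Hol_spectrum (composition_op \<phi>)"
  proof (rule ccontr)
    \<comment> \<open>The identity, cut off outside the disc, has no preimage. At parameter 0 the
      shifted operator is minus composition, so a preimage \<open>f\<close> would satisfy
      \<open>- f (\<phi> z) = z\<close>; at \<alpha> the left side has derivative 0 and the right
      side has derivative 1.\<close>
    define e where "e z = (if z \<in> unit_disc then z else 0)" for z :: complex
    have "(\<lambda>z. z) holomorphic_on unit_disc" by simp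
    then have "e holomorphic_on unit_disc"
      by (rule holomorphic_transform) (simp add: e_def)
    then have "e \<in> Hol_disc" by (simp add: Hol_disc_def e_def)
    moreover assume "0 \<notin> Hol_spectrum (composition_op \<phi>)"
    ultimately obtain f where f: "f \<in> Hol_disc" "shifted_op (composition_op \<phi>) 0 f = e"
      by (auto simp: Hol_spectrum_def bij_betw_def) (metis imageE)
    have f\<phi>: "- f (\<phi> z) = z" if "z \<in> unit_disc" for z
      using fun_cong[OF f(2), of z] that
      by (simp add: shifted_op_def composition_op_def e_def del: mem_ball mem_ball_0)
    have d\<phi>: "(\<phi> has_field_derivative 0) (at \<alpha>)"
      using holomorphic_derivI[OF hol _ \<alpha>_in] deriv_0 by simp
    have df: "(f has_field_derivative deriv f \<alpha>) (at (\<phi> \<alpha>))"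
      using holomorphic_derivI[of f unit_disc \<alpha>] f(1) \<alpha>_in fixed by (simp add: Hol_disc_def)
    have "((\<lambda>z. - (f \<circ> \<phi>) z) has_field_derivative - (deriv f \<alpha> * 0)) (at \<alpha>)"
      by (intro DERIV_minus DERIV_chain df d\<phi>)
    then have "((\<lambda>z. z) has_field_derivative - (deriv f \<alpha> * 0)) (at \<alpha>)"
      by (rule has_field_derivative_transform_within_open[OF _ open_ball \<alpha>_in]) (simp add: f\<phi>)
    then show False
      using DERIV_unique[OF _ DERIV_ident] by force
  qed
  moreover have "1 \<in> Hol_spectrum (composition_op \<phi>)"
  proof (rule ccontr)
    \<comment> \<open>The constant 1 on the disc lies in the kernel at parameter 1, so injectivity
      fails.\<close>
    define e :: "complex \<Rightarrow> complex" where "e z = (if z \<in> unit_disc then 1 else 0)" for z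
    have "(\<lambda>z. 1) holomorphic_on unit_disc" by simp
    then have "e holomorphic_on unit_disc"
      by (rule holomorphic_transform) (simp add: e_def)
    then have e: "e \<in> Hol_disc" by (simp add: Hol_disc_def e_def)
    have zero: "(\<lambda>_. 0) \<in> Hol_disc" by (simp add: Hol_disc_def)
    have "shifted_op (composition_op \<phi>) 1 e = shifted_op (composition_op \<phi>) 1 (\<lambda>_. 0)"
      using maps by (auto simp: shifted_op_def composition_op_def e_def fun_eq_iff
          image_subset_iff simp del: mem_ball mem_ball_0)
    moreover assume "1 \<notin> Hol_spectrum (composition_op \<phi>)"
    ultimately have "e = (\<lambda>_. 0)"
      using e zero by (auto simp: Hol_spectrum_def bij_betw_def dest: inj_onD)
    moreover have "e 0 = 1" by (simp add: e_def)
    ultimately show False by simp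
  qed
  moreover have "Hol_spectrum (composition_op \<phi>) \<subseteq> {0, 1}"
    using bij_betw_shifted_op by (auto simp: Hol_spectrum_def)
  ultimately show ?thesis by blast
qed

section \<open>Local boundedness of the resolvent and the Waelbroeck spectrum\<close>

text \<open>The distance of \<open>V\<close> from 0 controls the series through the common majorant,
  and its distance from 1 controls \<open>g \<alpha> / (c - 1)\<close>.\<close>

lemma bounded_Hol_resolvents:
  assumes g: "g \<in> Hol_disc" and \<delta>: "\<delta> > 0"
    and V: "\<And>c. c \<in> V \<Longrightarrow> norm c \<ge> \<delta> \<and> norm (c - 1) \<ge> \<delta>"
  shows "bounded_Hol ((\<lambda>c. Hol_resolvent (composition_op \<phi>) c g) ` V)"
proof -
  have nz: "c \<noteq> 0" "c \<noteq> 1" if "c \<in> V" for c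
    using V[OF that] \<delta> by auto
  have eq: "(\<lambda>c. Hol_resolvent (composition_op \<phi>) c g) ` V = (\<lambda>c. resolvent_series c g) ` V"
    by (rule image_cong[OF refl]) (rule Hol_resolvent_eq[OF nz g])
  show ?thesis
    unfolding eq bounded_Hol_def
  proof (intro conjI allI impI)
    show "(\<lambda>c. resolvent_series c g) ` V \<subseteq> Hol_disc"
      using resolvent_series_in_Hol_disc[OF g nz(1)] by auto
  next
    fix K assume K: "compact K \<and> K \<subseteq> unit_disc"
    obtain B where B: "summable B"
      "\<And>c n z. norm c \<ge> \<delta> \<Longrightarrow> z \<in> K \<Longrightarrow> norm (resolvent_term c g n z) \<le> B n"
      using resolvent_term_bound[OF g conjunct1[OF K] conjunct2[OF K] \<delta>] by blast
    have "norm (resolvent_series c g z) \<le> norm (g \<alpha>) / \<delta> + suminf B" if "c \<in> V" "z \<in> K" for c z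
    proof -
      have "norm (\<Sum>n. resolvent_term c g n z) \<le> suminf B"
        using B V[OF that(1)] that(2) by (intro norm_suminf_le) auto
      moreover have "norm (g \<alpha> / (c - 1)) \<le> norm (g \<alpha>) / \<delta>"
        using V[OF that(1)] \<delta> by (simp add: norm_divide frac_le)
      moreover have "z \<in> unit_disc" using K that(2) by blast
      ultimately show ?thesis
        unfolding resolvent_series_def by (auto intro: norm_triangle_mono)
    qed
    then show "\<exists>M. \<forall>f\<in>(\<lambda>c. resolvent_series c g) ` V. \<forall>z\<in>K. norm (f z) \<le> M"
      by blast
  qed
qed

lemma waelbroeck_spectrum_composition_op: "waelbroeck_spectrum (composition_op \<phi>) = {0, 1}"
proof -
  have "\<exists>V. c \<in> interior V \<and> V \<subseteq> - Hol_spectrum (composition_op \<phi>) \<and>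
      (\<forall>g\<in>Hol_disc. bounded_Hol ((\<lambda>\<mu>. Hol_resolvent (composition_op \<phi>) \<mu> g) ` V))"
    if c: "c \<noteq> 0" "c \<noteq> 1" for c
  proof -
    \<comment> \<open>Half the distance from \<open>c\<close> to the set of 0 and 1: by the triangle
      inequality every point of \<open>ball c \<delta>\<close> keeps distance at least \<delta> from
      both.\<close>
    define \<delta> where "\<delta> = min (norm c) (norm (c - 1)) / 2"
    have \<delta>: "\<delta> > 0" using c by (simp add: \<delta>_def)
    have V: "norm \<mu> \<ge> \<delta> \<and> norm (\<mu> - 1) \<ge> \<delta>" if "\<mu> \<in> ball c \<delta>" for \<mu>
    proof -
      have "norm (c - \<mu>) < \<delta>" using that by (simp add: dist_norm)
      moreover have "norm c \<le> norm (c - \<mu>) + norm \<mu>"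
        using norm_triangle_ineq[of "c - \<mu>" \<mu>] by simp
      moreover have "norm (c - 1) \<le> norm (c - \<mu>) + norm (\<mu> - 1)"
        using norm_triangle_ineq[of "c - \<mu>" "\<mu> - 1"] by simp
      moreover have "2 * \<delta> \<le> norm c" "2 * \<delta> \<le> norm (c - 1)" by (auto simp: \<delta>_def)
      ultimately show ?thesis by linarith
    qed
    have "c \<in> interior (ball c \<delta>)" using \<delta> by simp
    moreover have "ball c \<delta> \<subseteq> - Hol_spectrum (composition_op \<phi>)"
      using V \<delta> unfolding Hol_spectrum_composition_op by force
    ultimately show ?thesis
      using bounded_Hol_resolvents[OF _ \<delta> V] by blast
  qed
  \<comment> \<open>The points 0 and 1 belong to the Waelbroeck spectrum because it contains the
    spectrum by definition; the neighbourhoods just found exclude all other points.\<close>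
  then show ?thesis
    unfolding waelbroeck_spectrum_def Hol_spectrum_composition_op by auto
qed

end

theorem theorem4p10:
  fixes \<phi> :: "complex \<Rightarrow> complex" and \<alpha> :: complex
  assumes "\<phi> holomorphic_on unit_disc"
    and "\<phi> ` unit_disc \<subseteq> unit_disc"
    and "\<alpha> \<in> unit_disc"
    and "\<phi> \<alpha> = \<alpha>"
    and "deriv \<phi> \<alpha> = 0"
  shows "Hol_spectrum (composition_op \<phi>) = waelbroeck_spectrum (composition_op \<phi>) \<and>
         waelbroeck_spectrum (composition_op \<phi>) = {0, 1}"
proof -
  interpret superattracting_self_map \<phi> \<alpha>
    using assms by unfold_locales
  show ?thesis
    by (simp add: Hol_spectrum_composition_op waelbroeck_spectrum_composition_op)
qed

end
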